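(* Let $k\ge 1$ and let $\mathcal{X}\subseteq\Omega_k$ be a closed set of permutations. Then $\mathcal{X}$ is regular if and only if its basis $B(\mathcal{X})$ is regular.
   Context: A permutation of length $n\ge 0$ is an arrangement $\pi=\pi_1\ldots\pi_n$ of $1,\ldots,n$ (the empty permutation is allowed). $\pi\preceq\sigma$ ($\pi$ is involved in $\sigma$) means $\pi$ is order isomorphic to a (not necessarily contiguous) subsequence of $\sigma$. A set $\mathcal{X}$ of permutations is closed if $\sigma\in\mathcal{X}$ and $\pi\preceq\sigma$ imply $\pi\in\mathcal{X}$. The basis $B(\mathcal{X})$ of a closed set $\mathcal{X}$ is the set of $\preceq$-minimal permutations not belonging to $\mathcal{X}$. For $k\ge1$, $\Omega_k$ is the closed set whose basis consists of the $k!$ permutations $k+1,a_1,\ldots,a_k$ of length $k+1$, where $a_1,\ldots,a_k$ ranges over all permutations of $1,\ldots,k$. The rank encoding of $\pi=\pi_1\ldots\pi_n$ is the word $E(\pi)=p_1\ldots p_n$ with $p_i=|\{j\mid j\ge i,\ \pi_j\le\pi_i\}|$. The map $E$ is injective, and $\pi\in\Omega_k$ if and only if $E(\pi)\in[k]^*$, where $[k]=\{1,\ldots,k\}$. For a set $S$ of permutations, $E(S)=\{E(\pi)\mid\pi\in S\}$. A set $S$ of permutations contained in $\Omega_m$ for some $m$ is called regular if $E(S)$ is a regular language over $[m]$ (this does not depend on the choice of $m$). If $\mathcal{X}\subseteq\Omega_k$ is closed then $B(\mathcal{X})\subseteq\Omega_{k+1}$. *)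

theory Defs
  imports Main "HOL-Library.Sublist"
begin

text \<open>Permutations, including the empty one, are lists in one-line notation with entries \<open>1, \<dots>, n\<close>.
  List positions are counted from 0, entries from 1.\<close>

definition perms :: "nat list set" where
  "perms = {p. distinct p \<and> set p = {1..length p}}"

definition order_iso :: "nat list \<Rightarrow> nat list \<Rightarrow> bool" where
  "order_iso s t \<longleftrightarrow> length s = length t \<and>
     (\<forall>i<length s. \<forall>j<length s. s ! i < s ! j \<longleftrightarrow> t ! i < t ! j)"

definition involved :: "nat list \<Rightarrow> nat list \<Rightarrow> bool"  (infix "\<preceq>" 50) where
  "p \<preceq> s \<longleftrightarrow> (\<exists>t. subseq t s \<and> order_iso p t)"

definition perm_closed :: "nat list set \<Rightarrow> bool" where
  "perm_closed X \<longleftrightarrow> X \<subseteq> perms \<and> (\<forall>s\<in>X. \<forall>p\<in>perms. p \<preceq> s \<longrightarrow> p \<in> X)"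

definition basis :: "nat list set \<Rightarrow> nat list set" where
  "basis X = {p \<in> perms. p \<notin> X \<and> (\<forall>q\<in>perms. q \<notin> X \<longrightarrow> q \<preceq> p \<longrightarrow> q = p)}"

definition Omega_basis :: "nat \<Rightarrow> nat list set" where
  "Omega_basis k = {(k + 1) # a | a. a \<in> perms \<and> length a = k}"

text \<open>The permutations avoiding every member of \<open>Omega_basis k\<close>; by \<open>Omega_unique\<close> below this is
  the one closed set whose basis is \<open>Omega_basis k\<close>.\<close>

definition Omega :: "nat \<Rightarrow> nat list set" where
  "Omega k = {p \<in> perms. \<forall>b\<in>Omega_basis k. \<not> b \<preceq> p}"

definition rank_enc :: "nat list \<Rightarrow> nat list" where
  "rank_enc p = map (\<lambda>i. card {j. i \<le> j \<and> j < length p \<and> p ! j \<le> p ! i}) [0..<length p]"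

text \<open>Languages over \<open>A\<close> recognised by a deterministic finite automaton, with states taken
  without loss of generality from the natural numbers.\<close>

definition regular_lang :: "'a set \<Rightarrow> 'a list set \<Rightarrow> bool" where
  "regular_lang A L \<longleftrightarrow>
     (\<exists>(Q :: nat set) \<delta> q0 F. finite Q \<and> q0 \<in> Q \<and> F \<subseteq> Q \<and> (\<forall>q\<in>Q. \<forall>a\<in>A. \<delta> q a \<in> Q) \<and>
        L = {w \<in> lists A. foldl \<delta> q0 w \<in> F})"

definition regular_perms :: "nat list set \<Rightarrow> bool" where
  "regular_perms S \<longleftrightarrow> (\<exists>m\<ge>1. S \<subseteq> Omega m \<and> regular_lang {1..m} (rank_enc ` S))"

lemma order_iso_refl: "order_iso s s"
  by (simp add: order_iso_def)

lemma order_iso_trans: "order_iso s t \<Longrightarrow> order_iso t u \<Longrightarrow> order_iso s u"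
  by (simp add: order_iso_def)

lemma order_iso_subseq:
  assumes "subseq t s" "order_iso s u"
  shows "\<exists>t'. subseq t' u \<and> order_iso t t'"
proof -
  from assms(1) obtain N where t: "t = nths s N"
    by (auto simp: subseq_conv_nths)
  have len: "length s = length u"
    using assms(2) by (simp add: order_iso_def)
  define z where "z = nths (zip s u) N"
  have f: "map fst z = t"
    unfolding z_def t using len by (simp flip: nths_map)
  have g: "map snd z = nths u N"
    unfolding z_def using len by (simp flip: nths_map)
  have *: "fst x < fst y \<longleftrightarrow> snd x < snd y" if "x \<in> set z" "y \<in> set z" for x y
  proof -
    have "x \<in> set (zip s u)" "y \<in> set (zip s u)"
      using that by (auto simp: z_def dest: in_set_nthsD)
    then show ?thesis
      using assms(2) len by (auto simp: set_zip order_iso_def)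
  qed
  have "order_iso (map fst z) (map snd z)"
    using * by (simp add: order_iso_def)
  then have "order_iso t (nths u N)"
    by (simp only: f g)
  moreover have "subseq (nths u N) u"
    by (auto simp: subseq_conv_nths)
  ultimately show ?thesis
    by blast
qed

lemma involved_refl: "p \<preceq> p"
  unfolding involved_def using order_iso_refl by blast

lemma involved_trans:
  assumes "p \<preceq> q" "q \<preceq> r"
  shows "p \<preceq> r"
proof -
  obtain s where s: "subseq s q" "order_iso p s"
    using assms(1) by (auto simp: involved_def)
  obtain t where t: "subseq t r" "order_iso q t"
    using assms(2) by (auto simp: involved_def)
  obtain u where u: "subseq u t" "order_iso s u"
    using order_iso_subseq[OF s(1) t(2)] by blast
  have "subseq u r"
    using u(1) t(1) by (rule subseq_order.order_trans)
  then show ?thesis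
    using order_iso_trans[OF s(2) u(2)] by (auto simp: involved_def)
qed

lemma involved_length: "p \<preceq> q \<Longrightarrow> length p \<le> length q"
  by (auto simp: involved_def order_iso_def dest: list_emb_length)

lemma perm_nth:
  assumes "p \<in> perms" "i < length p"
  shows "p ! i = card {j. j < length p \<and> p ! j \<le> p ! i}"
proof -
  have d: "distinct p" and s: "set p = {1..length p}"
    using assms(1) by (auto simp: perms_def)
  have "(\<lambda>j. p ! j) ` {j. j < length p \<and> p ! j \<le> p ! i} = {x \<in> set p. x \<le> p ! i}"
    by (auto simp: in_set_conv_nth)
  also have "\<dots> = {1..p ! i}"
    using s nth_mem[OF assms(2)] by auto
  finally have "card ((\<lambda>j. p ! j) ` {j. j < length p \<and> p ! j \<le> p ! i}) = p ! i"
    by simp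
  moreover have "inj_on (\<lambda>j. p ! j) {j. j < length p \<and> p ! j \<le> p ! i}"
    using d by (auto simp: inj_on_def nth_eq_iff_index_eq)
  ultimately show ?thesis
    by (simp add: card_image)
qed

lemma order_iso_perms_eq:
  assumes "p \<in> perms" "q \<in> perms" "order_iso p q"
  shows "p = q"
proof (rule nth_equalityI)
  show l: "length p = length q"
    using assms(3) by (simp add: order_iso_def)
  fix i assume i: "i < length p"
  have eq: "{j. j < length p \<and> p ! j \<le> p ! i} = {j. j < length q \<and> q ! j \<le> q ! i}"
  proof -
    have "p ! j \<le> p ! i \<longleftrightarrow> q ! j \<le> q ! i" if "j < length p" for j
      using assms(3) i that unfolding order_iso_def by (meson not_less)
    then show ?thesis
      using l by auto
  qed
  have "i < length q"
    using i l by simp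
  from perm_nth[OF assms(1) i] perm_nth[OF assms(2) this] show "p ! i = q ! i"
    unfolding eq by (rule trans[OF _ sym])
qed

lemma involved_same_length:
  assumes "p \<in> perms" "q \<in> perms" "p \<preceq> q" "length p = length q"
  shows "p = q"
proof -
  obtain t where t: "subseq t q" "order_iso p t"
    using assms(3) by (auto simp: involved_def)
  then have "length t = length q"
    using assms(4) by (simp add: order_iso_def)
  then have "t = q"
    using t(1) subseq_same_length by blast
  then show ?thesis
    using t(2) order_iso_perms_eq assms(1,2) by blast
qed

lemma basis_below:
  assumes "p \<in> perms" "p \<notin> X"
  shows "\<exists>b\<in>basis X. b \<preceq> p"
  using assms
proof (induction "length p" arbitrary: p rule: less_induct)
  case less
  show ?case
  proof (cases "p \<in> basis X")
    case True
    then show ?thesis using involved_refl by blast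
  next
    case False
    then obtain q where q: "q \<in> perms" "q \<notin> X" "q \<preceq> p" "q \<noteq> p"
      using less.prems by (auto simp: basis_def)
    then have "length q < length p"
      using involved_length[OF q(3)] involved_same_length[OF q(1) less.prems(1) q(3)]
      by linarith
    then obtain b where "b \<in> basis X" "b \<preceq> q"
      using less.hyps q(1,2) by blast
    then show ?thesis
      using involved_trans q(3) by blast
  qed
qed

lemma closed_eq_avoid:
  assumes "perm_closed X"
  shows "X = {p \<in> perms. \<forall>b\<in>basis X. \<not> b \<preceq> p}"
proof -
  have "\<not> b \<preceq> p" if "p \<in> X" "b \<in> basis X" for p b
  proof
    assume "b \<preceq> p"
    moreover have "b \<in> perms" "b \<notin> X"
      using that(2) by (simp_all add: basis_def)
    ultimately show False
      using that(1) assms unfolding perm_closed_def by blast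
  qed
  moreover have "p \<in> X" if "p \<in> perms" "\<forall>b\<in>basis X. \<not> b \<preceq> p" for p
  proof (rule ccontr)
    assume "p \<notin> X"
    from basis_below[OF that(1) this] that(2) show False by blast
  qed
  moreover have "X \<subseteq> perms"
    using assms by (simp add: perm_closed_def)
  ultimately show ?thesis
    by (intro set_eqI iffI) (simp_all add: subset_iff)
qed

lemma Omega_basis_perms: "b \<in> Omega_basis k \<Longrightarrow> b \<in> perms \<and> length b = k + 1"
proof -
  assume "b \<in> Omega_basis k"
  then obtain a where a: "b = (k + 1) # a" "distinct a" "set a = {1..k}" "length a = k"
    by (auto simp: Omega_basis_def perms_def)
  have "insert (k + 1) {1..k} = {1..k + 1}"
    by auto
  then show ?thesis
    using a by (simp add: perms_def)
qed

lemma Omega_closed: "perm_closed (Omega k)"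
proof -
  have "p \<in> Omega k" if "s \<in> Omega k" "p \<in> perms" "p \<preceq> s" for s p
  proof -
    have "\<not> b \<preceq> p" if "b \<in> Omega_basis k" for b
      using involved_trans[OF _ \<open>p \<preceq> s\<close>] that \<open>s \<in> Omega k\<close> by (auto simp: Omega_def)
    then show ?thesis
      using \<open>p \<in> perms\<close> by (simp add: Omega_def)
  qed
  moreover have "Omega k \<subseteq> perms"
    by (auto simp: Omega_def)
  ultimately show ?thesis
    unfolding perm_closed_def by blast
qed

lemma basis_Omega: "basis (Omega k) = Omega_basis k"
proof
  show "basis (Omega k) \<subseteq> Omega_basis k"
  proof
    fix p assume p: "p \<in> basis (Omega k)"
    then obtain b where b: "b \<in> Omega_basis k" "b \<preceq> p"
      by (auto simp: basis_def Omega_def)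
    then have "b \<in> perms" "b \<notin> Omega k"
      using Omega_basis_perms[OF b(1)] b(1) involved_refl[of b] by (auto simp: Omega_def)
    then show "p \<in> Omega_basis k"
      using p b by (simp add: basis_def) blast
  qed
  show "Omega_basis k \<subseteq> basis (Omega k)"
  proof
    fix b assume b: "b \<in> Omega_basis k"
    have "q = b" if q: "q \<in> perms" "q \<notin> Omega k" "q \<preceq> b" for q
    proof -
      obtain c where c: "c \<in> Omega_basis k" "c \<preceq> q"
        using q by (auto simp: Omega_def)
      then have "length q = length b"
        using involved_length[OF c(2)] involved_length[OF q(3)] Omega_basis_perms[OF b]
          Omega_basis_perms[OF c(1)] by linarith
      then show ?thesis
        using involved_same_length[OF q(1) _ q(3)] Omega_basis_perms[OF b] by blast
    qed
    then show "b \<in> basis (Omega k)"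
      using b Omega_basis_perms[OF b] involved_refl[of b] by (simp add: basis_def) (auto simp: Omega_def)
  qed
qed

lemma Omega_unique: "perm_closed X \<and> basis X = Omega_basis k \<longleftrightarrow> X = Omega k"
proof
  assume "perm_closed X \<and> basis X = Omega_basis k"
  then show "X = Omega k"
    using closed_eq_avoid[of X] unfolding Omega_def by simp
next
  assume "X = Omega k"
  then show "perm_closed X \<and> basis X = Omega_basis k"
    using Omega_closed basis_Omega by simp
qed

end

theory Submission
  imports Defs
begin

text \<open>A closed set and its basis determine each other by Boolean operations and one order-theoretic
  operation, the strict upward closure \<open>U\<^sub>m S\<close>: the set of all permutations in \<open>Omega m\<close> that
  properly involve a member of \<open>S\<close>. On the one hand
  \<open>X = Omega k - (basis X \<union> U\<^sub>k (basis X))\<close> (\<open>closed_eq_Omega_Diff\<close>). On the other hand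
  \<open>basis X \<subseteq> Omega (k + 1)\<close> (\<open>basis_subset_Omega\<close>), so with \<open>Y = Omega (k + 1) - X\<close> the basis
  consists of the minimal elements of \<open>Y\<close>, that is \<open>basis X = Y - U\<^sub>k\<^sub>+\<^sub>1 Y\<close> (\<open>basis_eq_minimal\<close>).
  Since the rank encoding is injective, Boolean operations on sets of permutations become Boolean
  operations on languages. It remains to see that the codes of \<open>Omega k\<close> form a regular language
  (\<open>recognizable_Omega\<close>) and that \<open>U\<^sub>m\<close> preserves regularity (\<open>recognizable_strictly_above\<close>).

  The second point is the heart of the matter. Deleting entries from a permutation acts on its code
  as a transduction: an entry whose code letter is \<open>p\<close> is the \<open>p\<close>-th smallest of those not yet read,
  and after the deletion its letter is the number of survivors among the \<open>p\<close> smallest. For letters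
  at most \<open>m\<close> it suffices to know which of the \<open>m\<close> smallest unread entries survive, and a
  nondeterministic automaton can guess this (\<open>recognizable_thinnable\<close>). That the code of the result
  then really identifies an involved permutation is \<open>rank_enc_eq_imp_order_iso\<close>: lists with distinct
  entries and equal codes are order isomorphic.\<close>

section \<open>Languages with finitely many residuals\<close>

definition residual :: "'a list \<Rightarrow> 'a list set \<Rightarrow> 'a list set" where
  "residual u L = {v. u @ v \<in> L}"

text \<open>The Myhill-Nerode form of regularity. It does not mention the alphabet, so codes over
  different alphabets \<open>{1..m}\<close> can be combined freely.\<close>

definition recognizable :: "'a list set \<Rightarrow> bool" where
  "recognizable L \<longleftrightarrow> finite (range (\<lambda>u. residual u L))"

lemma residual_append: "residual (u @ v) L = residual v (residual u L)"
  by (simp add: residual_def)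

lemma residual_Nil [simp]: "residual [] L = L"
  by (simp add: residual_def)

lemma mem_residual: "v \<in> residual u L \<longleftrightarrow> u @ v \<in> L"
  by (simp add: residual_def)

lemma regular_lang_imp_recognizable:
  assumes "regular_lang A L"
  shows "recognizable L"
proof -
  obtain Q :: "nat set" and \<delta> q0 F where Q: "finite Q" "q0 \<in> Q" "\<forall>q\<in>Q. \<forall>a\<in>A. \<delta> q a \<in> Q"
    and L: "L = {w \<in> lists A. foldl \<delta> q0 w \<in> F}"
    using assms unfolding regular_lang_def by blast
  have run: "foldl \<delta> q u \<in> Q" if "u \<in> lists A" "q \<in> Q" for u q
    using that by (induction u arbitrary: q) (use Q(3) in auto)
  define acc where "acc q = {v \<in> lists A. foldl \<delta> q v \<in> F}" for q
  have "residual u L \<in> insert {} (acc ` Q)" for u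
  proof (cases "u \<in> lists A")
    case True
    then have "residual u L = acc (foldl \<delta> q0 u)"
      by (auto simp: residual_def L acc_def)
    then show ?thesis
      using run[OF True Q(2)] by blast
  next
    case False
    then have "residual u L = {}"
      by (auto simp: residual_def L)
    then show ?thesis by simp
  qed
  then have "range (\<lambda>u. residual u L) \<subseteq> insert {} (acc ` Q)"
    by blast
  then show ?thesis
    unfolding recognizable_def by (rule finite_subset) (simp add: Q(1))
qed

text \<open>The residuals themselves, numbered by an injection \<open>f\<close>, serve as the states.\<close>

lemma recognizable_imp_regular_lang:
  assumes "recognizable L" "L \<subseteq> lists A"
  shows "regular_lang A L"
proof -
  let ?R = "range (\<lambda>u. residual u L)"
  obtain f :: "'a list set \<Rightarrow> nat" where f: "inj_on f ?R"
    using finite_imp_inj_to_nat_seg[OF assms(1)[unfolded recognizable_def]] by blast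
  define g where "g = inv_into ?R f"
  have g: "g (f (residual u L)) = residual u L" for u
    unfolding g_def using f by (intro inv_into_f_f) auto
  define \<delta> where "\<delta> q a = f (residual [a] (g q))" for q a
  have step: "\<delta> (f (residual u L)) a = f (residual (u @ [a]) L)" for u a
    by (simp add: \<delta>_def g residual_append)
  have run: "foldl \<delta> (f (residual [] L)) w = f (residual w L)" for w
    by (induction w rule: rev_induct) (simp_all add: step del: residual_Nil)
  let ?F = "f ` {R \<in> ?R. [] \<in> R}"
  have acc: "f (residual w L) \<in> ?F \<longleftrightarrow> w \<in> L" for w
  proof -
    have "f (residual w L) \<in> ?F \<longleftrightarrow> [] \<in> residual w L"
      using f by (auto simp: inj_on_def)
    then show ?thesis by (simp add: mem_residual)
  qed
  show ?thesis
    unfolding regular_lang_def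
  proof (intro exI conjI)
    show "finite (f ` ?R)"
      using assms(1) by (simp add: recognizable_def)
    show "f (residual [] L) \<in> f ` ?R"
      by blast
    show "?F \<subseteq> f ` ?R"
      by blast
    show "\<forall>q\<in>f ` ?R. \<forall>a\<in>A. \<delta> q a \<in> f ` ?R"
      using step by auto
    show "L = {w \<in> lists A. foldl \<delta> (f (residual [] L)) w \<in> ?F}"
      unfolding run acc using assms(2) by blast
  qed
qed

text \<open>The residuals of \<open>L \<union> M\<close> and of \<open>L - M\<close> at \<open>u\<close> are determined by those of \<open>L\<close> and \<open>M\<close> at
  \<open>u\<close>, so there are at most as many as there are pairs. This argument does not care which Boolean
  operation is used.\<close>

lemma recognizable_combine:
  assumes "recognizable L" "recognizable M"
    and "\<And>u. residual u N = h (residual u L) (residual u M)"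
  shows "recognizable N"
proof -
  have "range (\<lambda>u. residual u N) \<subseteq>
      (\<lambda>(R, S). h R S) ` (range (\<lambda>u. residual u L) \<times> range (\<lambda>u. residual u M))"
    unfolding assms(3) by force
  then show ?thesis
    unfolding recognizable_def
    by (rule finite_subset)
      (intro finite_imageI finite_cartesian_product assms(1,2)[unfolded recognizable_def])
qed

lemma recognizable_Un: "recognizable L \<Longrightarrow> recognizable M \<Longrightarrow> recognizable (L \<union> M)"
  by (erule (1) recognizable_combine[where h = "(\<union>)"]) (simp add: residual_def set_eq_iff)

lemma recognizable_Int: "recognizable L \<Longrightarrow> recognizable M \<Longrightarrow> recognizable (L \<inter> M)"
  by (erule (1) recognizable_combine[where h = "(\<inter>)"]) (simp add: residual_def set_eq_iff)

lemma recognizable_Diff: "recognizable L \<Longrightarrow> recognizable M \<Longrightarrow> recognizable (L - M)"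
  by (erule (1) recognizable_combine[where h = "(-)"]) (simp add: residual_def set_eq_iff)

text \<open>This is the subset construction in the language of residuals: the members of \<open>\<F>\<close> are the
  languages accepted from the states of a nondeterministic automaton. Reading one letter turns a
  union of members into another such union, and there are only finitely many unions.\<close>

lemma recognizable_Union_family:
  assumes "finite \<F>" "\<And>L a. L \<in> \<F> \<Longrightarrow> \<exists>\<G>\<subseteq>\<F>. residual [a] L = \<Union>\<G>" "\<G> \<subseteq> \<F>"
  shows "recognizable (\<Union>\<G>)"
proof -
  have step: "residual [a] L \<in> Union ` Pow \<F>" if L: "L \<in> Union ` Pow \<F>" for L a
  proof -
    obtain \<H> where H: "\<H> \<subseteq> \<F>" "L = \<Union>\<H>"
      using L by blast
    then have "\<forall>M\<in>\<H>. \<exists>\<G>\<subseteq>\<F>. residual [a] M = \<Union>\<G>"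
      using assms(2) by blast
    then obtain G where G: "\<And>M. M \<in> \<H> \<Longrightarrow> G M \<subseteq> \<F> \<and> residual [a] M = \<Union>(G M)"
      by metis
    have "residual [a] L = (\<Union>M\<in>\<H>. residual [a] M)"
      by (auto simp: H(2) residual_def)
    also have "\<dots> = \<Union>(\<Union>M\<in>\<H>. G M)"
      using G by auto
    finally show ?thesis
      using G by blast
  qed
  have "residual u (\<Union>\<G>) \<in> Union ` Pow \<F>" for u
    by (induction u rule: rev_induct) (use assms(3) step in \<open>auto simp: residual_append\<close>)
  then have "range (\<lambda>u. residual u (\<Union>\<G>)) \<subseteq> Union ` Pow \<F>"
    by blast
  then show ?thesis
    unfolding recognizable_def by (rule finite_subset) (simp add: assms(1))
qed

section \<open>Ranks and rank encodings of lists with distinct entries\<close>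

definition rank :: "nat set \<Rightarrow> nat \<Rightarrow> nat" where
  "rank A x = card {y \<in> A. y \<le> x}"

lemma rank_less:
  assumes "finite A" "y \<in> A" "x < y"
  shows "rank A x < rank A y"
proof -
  have "{z \<in> A. z \<le> x} \<subset> {z \<in> A. z \<le> y}"
    using assms(2,3) by (intro psubsetI subsetI notI) (auto dest: equalityD2[THEN subsetD, of _ _ y])
  then show ?thesis
    unfolding rank_def using assms(1) by (intro psubset_card_mono) auto
qed

lemma inj_on_rank:
  assumes "finite A"
  shows "inj_on (rank A) A"
proof (rule inj_onI)
  fix x y assume "x \<in> A" "y \<in> A" "rank A x = rank A y"
  then show "x = y"
    using rank_less[OF assms, of x y] rank_less[OF assms, of y x] by (cases x y rule: linorder_cases) auto
qed

lemma rank_image_below: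
  assumes "finite A" "x \<in> A"
  shows "rank A ` {y \<in> A. y \<le> x} = {1..rank A x}"
proof (rule card_subset_eq)
  show "rank A ` {y \<in> A. y \<le> x} \<subseteq> {1..rank A x}"
  proof
    fix r assume "r \<in> rank A ` {y \<in> A. y \<le> x}"
    then obtain y where y: "y \<in> A" "y \<le> x" "r = rank A y"
      by blast
    have "0 < rank A y"
      unfolding rank_def using assms(1) y(1) by (subst card_gt_0_iff) auto
    moreover have "rank A y \<le> rank A x"
      unfolding rank_def using assms(1) y(2) by (intro card_mono) auto
    ultimately show "r \<in> {1..rank A x}"
      using y(3) by simp
  qed
  have "inj_on (rank A) {y \<in> A. y \<le> x}"
    using inj_on_rank[OF assms(1)] by (rule inj_on_subset) blast
  then have "card (rank A ` {y \<in> A. y \<le> x}) = rank A x"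
    by (simp only: card_image rank_def[of A x])
  then show "card (rank A ` {y \<in> A. y \<le> x}) = card {1..rank A x}"
    by simp
qed simp

lemma rank_insert:
  assumes "finite A" "x \<notin> A"
  shows "rank (insert x A) y = (if x \<le> y then Suc (rank A y) else rank A y)"
proof -
  have "{z \<in> insert x A. z \<le> y} = (if x \<le> y then insert x {z \<in> A. z \<le> y} else {z \<in> A. z \<le> y})"
    by auto
  then show ?thesis
    using assms by (simp add: rank_def)
qed

lemma rank_atLeastAtMost: "x \<in> {1..n} \<Longrightarrow> rank {1..n} x = x"
proof -
  assume "x \<in> {1..n}"
  then have "{y \<in> {1..n}. y \<le> x} = {1..x}"
    by auto
  then show ?thesis by (simp add: rank_def)
qed

lemma length_rank_enc [simp]: "length (rank_enc s) = length s"
  by (simp add: rank_enc_def)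

lemma rank_enc_Nil [simp]: "rank_enc [] = []"
  by (simp add: rank_enc_def)

lemma rank_enc_Cons:
  assumes "distinct (x # xs)"
  shows "rank_enc (x # xs) = rank (set (x # xs)) x # rank_enc xs"
proof (rule nth_equalityI)
  fix i assume "i < length (rank_enc (x # xs))"
  then have i: "i < Suc (length xs)"
    by simp
  show "rank_enc (x # xs) ! i = (rank (set (x # xs)) x # rank_enc xs) ! i"
  proof (cases i)
    case 0
    let ?J = "{j. j < Suc (length xs) \<and> (x # xs) ! j \<le> x}"
    have img: "(\<lambda>j. (x # xs) ! j) ` ?J = {y \<in> set (x # xs). y \<le> x}"
      unfolding set_conv_nth by auto
    have "inj_on (\<lambda>j. (x # xs) ! j) ?J"
      using assms by (intro inj_on_nth) auto
    then have "card ?J = rank (set (x # xs)) x"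
      unfolding rank_def img[symmetric] by (rule card_image[symmetric])
    then show ?thesis
      using 0 by (simp add: rank_enc_def del: upt_Suc)
  next
    case (Suc i')
    have "{j. Suc i' \<le> j \<and> j < Suc (length xs) \<and> (x # xs) ! j \<le> xs ! i'} =
        Suc ` {j. i' \<le> j \<and> j < length xs \<and> xs ! j \<le> xs ! i'}" (is "?A = Suc ` ?B")
    proof
      show "?A \<subseteq> Suc ` ?B"
      proof
        fix j assume "j \<in> ?A"
        then show "j \<in> Suc ` ?B"
          by (cases j) auto
      qed
    qed auto
    then have "card ?A = card ?B"
      by (simp add: card_image)
    then show ?thesis
      using Suc i by (simp add: rank_enc_def del: upt_Suc)
  qed
qed simp

lemma order_iso_imp_rank_enc_eq:
  assumes "order_iso s t"
  shows "rank_enc s = rank_enc t"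
proof -
  have "s ! j \<le> s ! i \<longleftrightarrow> t ! j \<le> t ! i" if "i < length s" "j < length s" for i j
    using assms that unfolding order_iso_def by (meson not_less)
  then have "{j. i \<le> j \<and> j < length s \<and> s ! j \<le> s ! i} = {j. i \<le> j \<and> j < length s \<and> t ! j \<le> t ! i}"
    if "i < length s" for i
    using that by blast
  moreover have "length s = length t"
    using assms by (simp add: order_iso_def)
  ultimately show ?thesis
    by (simp add: rank_enc_def)
qed

text \<open>The first code letter says how many of the later entries lie below the first entry. Inside an
  order-isomorphic pair of tails, the positions of those entries form initial segments of the same
  linear order, and initial segments of equal size coincide.\<close>

lemma rank_enc_eq_imp_order_iso:
  assumes "distinct s" "distinct t" "rank_enc s = rank_enc t"
  shows "order_iso s t"
  using assms
proof (induction s arbitrary: t)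
  case Nil
  then have "length t = 0"
    by (metis length_rank_enc list.size(3))
  then show ?case by (simp add: order_iso_def)
next
  case (Cons x xs)
  have "length t = length (x # xs)"
    using Cons.prems(3) by (metis length_rank_enc)
  then obtain y ys where t: "t = y # ys"
    by (cases t) auto
  have d: "distinct (x # xs)" "distinct (y # ys)"
    using Cons.prems t by auto
  have heads: "rank (set (x # xs)) x = rank (set (y # ys)) y" and tails: "rank_enc xs = rank_enc ys"
    using Cons.prems(3) unfolding t rank_enc_Cons[OF d(1)] rank_enc_Cons[OF d(2)] by simp_all
  have iso: "order_iso xs ys"
    using Cons.IH tails d by simp
  then have len: "length ys = length xs"
    by (simp add: order_iso_def)
  have below: "rank (set (z # zs)) z = Suc (card {i. i < length zs \<and> zs ! i < z})"
    if "distinct (z # zs)" for z zs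
  proof -
    have img: "(\<lambda>i. zs ! i) ` {i. i < length zs \<and> zs ! i < z} = {v \<in> set zs. v \<le> z}"
      using that unfolding set_conv_nth by (auto simp: less_le)
    have "inj_on (\<lambda>i. zs ! i) {i. i < length zs \<and> zs ! i < z}"
      using that by (intro inj_on_nth) auto
    then have "card {i. i < length zs \<and> zs ! i < z} = rank (set zs) z"
      unfolding rank_def img[symmetric] by (rule card_image[symmetric])
    then show ?thesis
      using that by (simp add: rank_insert)
  qed
  let ?A = "{i. i < length xs \<and> xs ! i < x}" and ?B = "{i. i < length xs \<and> ys ! i < y}"
  have card_eq: "card ?A = card ?B"
    using heads below[OF d(1)] below[OF d(2)] len by simp
  have "?A \<subseteq> ?B \<or> ?B \<subseteq> ?A"
  proof (rule ccontr)
    assume "\<not> (?A \<subseteq> ?B \<or> ?B \<subseteq> ?A)"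
    then obtain i j where ij: "i < length xs" "j < length xs" "xs ! i < x" "\<not> ys ! i < y"
        "ys ! j < y" "\<not> xs ! j < x"
      by blast
    then have "xs ! i < xs ! j" "\<not> ys ! i < ys ! j"
      by auto
    then show False
      using iso ij(1,2) by (simp add: order_iso_def)
  qed
  then have AB: "?A = ?B"
  proof
    assume "?A \<subseteq> ?B"
    then show ?thesis
      using card_eq by (intro card_subset_eq) simp_all
  next
    assume "?B \<subseteq> ?A"
    then have "?B = ?A"
      using card_eq by (intro card_subset_eq) simp_all
    then show ?thesis ..
  qed
  have lower: "xs ! i < x \<longleftrightarrow> ys ! i < y" if "i < length xs" for i
    using AB that by blast
  have upper: "x < xs ! i \<longleftrightarrow> y < ys ! i" if "i < length xs" for i
  proof -
    have "xs ! i \<noteq> x" "ys ! i \<noteq> y"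
      using d that len by (metis distinct.simps(2) nth_mem)+
    then show ?thesis
      using lower[OF that] by auto
  qed
  show ?case
    unfolding order_iso_def t
  proof (intro conjI allI impI)
    fix i j assume "i < length (x # xs)" "j < length (x # xs)"
    then show "(x # xs) ! i < (x # xs) ! j \<longleftrightarrow> (y # ys) ! i < (y # ys) ! j"
      using lower upper iso by (cases i; cases j) (auto simp: order_iso_def)
  qed (simp add: len)
qed

lemma perms_distinct: "p \<in> perms \<Longrightarrow> distinct p"
  by (simp add: perms_def)

lemma inj_on_rank_enc: "inj_on rank_enc perms"
  using order_iso_perms_eq rank_enc_eq_imp_order_iso perms_distinct by (blast intro: inj_onI)

lemma standardize:
  assumes "distinct t"
  obtains p where "p \<in> perms" "order_iso p t"
proof
  let ?p = "map (rank (set t)) t"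
  have rank_iff: "rank (set t) x < rank (set t) y \<longleftrightarrow> x < y" if "x \<in> set t" "y \<in> set t" for x y
    using that rank_less[of "set t" y x] rank_less[of "set t" x y]
    by (cases x y rule: linorder_cases) auto
  show "order_iso ?p t"
    by (auto simp: order_iso_def rank_iff)
  have "set ?p \<subseteq> {1..length t}"
  proof
    fix r assume "r \<in> set ?p"
    then obtain x where x: "x \<in> set t" "r = rank (set t) x"
      by auto
    then have "r \<in> {1..rank (set t) x}"
      using rank_image_below[of "set t" x] by auto
    moreover have "rank (set t) x \<le> card (set t)"
      unfolding rank_def by (intro card_mono) auto
    ultimately show "r \<in> {1..length t}"
      using card_length[of t] by auto
  qed
  moreover have "distinct ?p"
    using assms inj_on_rank by (simp add: distinct_map)
  ultimately have "set ?p = {1..length t}"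
    using distinct_card[of ?p] by (intro card_subset_eq) auto
  then show "?p \<in> perms"
    using \<open>distinct ?p\<close> by (simp add: perms_def)
qed

section \<open>Thinning a code word\<close>

definition close_gap :: "nat \<Rightarrow> nat set \<Rightarrow> nat set" where
  "close_gap p K = {v. if v < p then v \<in> K else Suc v \<in> K}"

text \<open>The effect of deleting entries on the code. If \<open>w\<close> encodes \<open>s\<close> and \<open>K\<close> is the set of the ranks
  (among the entries of \<open>s\<close>) of those entries that survive, then \<open>thin K w\<close> encodes the surviving
  subsequence. Once the first entry, of rank \<open>p\<close>, has been read, the ranks above \<open>p\<close> drop by one.\<close>

fun thin :: "nat set \<Rightarrow> nat list \<Rightarrow> nat list" where
  "thin K [] = []"
| "thin K (p # w) =
     (if p \<in> K then card (K \<inter> {1..p}) # thin (close_gap p K) w else thin (close_gap p K) w)"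

lemma length_thin_le: "length (thin K w) \<le> length w"
  by (induction K w rule: thin.induct) auto

lemma thin_letter_le: "c \<in> set (thin K w) \<Longrightarrow> \<exists>p\<in>set w. c \<le> p"
proof (induction K w rule: thin.induct)
  case (2 K p w)
  have "card (K \<inter> {1..p}) \<le> card {1..p}"
    by (intro card_mono) auto
  then show ?case
    using 2 by (auto split: if_splits)
qed simp

lemma thin_rank_enc:
  assumes "distinct s"
  shows "thin K (rank_enc s) = rank_enc (filter (\<lambda>x. rank (set s) x \<in> K) s)"
  using assms
proof (induction s arbitrary: K)
  case (Cons x s)
  let ?A = "set (x # s)"
  let ?p = "rank ?A x"
  let ?f = "filter (\<lambda>y. rank ?A y \<in> K) s"
  have x: "x \<notin> set s"
    using Cons.prems by simp
  have p: "?p = Suc (rank (set s) x)"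
    using x by (simp add: rank_insert)
  have shift: "rank (set s) y \<in> close_gap ?p K \<longleftrightarrow> rank ?A y \<in> K" if y: "y \<in> set s" for y
  proof (cases "y < x")
    case True
    then have "rank (set s) y \<le> rank (set s) x"
      unfolding rank_def by (intro card_mono) auto
    then show ?thesis
      using True x p by (simp add: close_gap_def rank_insert)
  next
    case False
    then have "x < y"
      using y x by (cases "x = y") auto
    then have "rank (set s) x < rank (set s) y"
      using y by (intro rank_less) auto
    then show ?thesis
      using \<open>x < y\<close> x p by (simp add: close_gap_def rank_insert)
  qed
  have rest: "thin (close_gap ?p K) (rank_enc s) = rank_enc ?f"
    using Cons shift by (simp cong: filter_cong)
  show ?case
  proof (cases "?p \<in> K")
    case True
    let ?B = "{y \<in> ?A. rank ?A y \<in> K \<and> y \<le> x}"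
    have window: "K \<inter> {1..?p} = rank ?A ` ?B"
      using rank_image_below[of ?A x] by auto
    have "inj_on (rank ?A) ?B"
      using inj_on_rank[of ?A] by (rule inj_on_subset) auto
    then have "card (K \<inter> {1..?p}) = card ?B"
      unfolding window by (rule card_image)
    also have "?B = {y \<in> set (x # ?f). y \<le> x}"
      using True by auto
    finally have "card (K \<inter> {1..?p}) = rank (set (x # ?f)) x"
      by (simp only: rank_def)
    moreover have "distinct (x # ?f)"
      using Cons.prems by simp
    ultimately show ?thesis
      using True rest rank_enc_Cons[OF Cons.prems] rank_enc_Cons[of x ?f] by simp
  next
    case False
    then show ?thesis
      using rest rank_enc_Cons[OF Cons.prems] by simp
  qed
qed simp

lemma subseq_imp_thin:
  assumes "distinct s" "subseq t s"
  shows "\<exists>K. rank_enc t = thin K (rank_enc s)"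
proof -
  let ?K = "rank (set s) ` set t"
  have t: "t = filter (\<lambda>x. x \<in> set t) s"
    using assms by (metis filter_in_nths subseq_conv_nths)
  have sub: "set t \<subseteq> set s"
    using assms(2) by (metis set_nths_subset subseq_conv_nths)
  have "rank (set s) x \<in> ?K \<longleftrightarrow> x \<in> set t" if "x \<in> set s" for x
    using inj_on_rank[of "set s"] sub that by (auto simp: inj_on_def)
  then have "filter (\<lambda>x. rank (set s) x \<in> ?K) s = t"
    by (subst t) (auto intro: filter_cong)
  then show ?thesis
    using thin_rank_enc[OF assms(1), of ?K] by metis
qed

section \<open>The codes of the permutations in \<open>Omega k\<close>\<close>

lemma set_rank_enc_conv:
  "distinct s \<Longrightarrow> c \<in> set (rank_enc s) \<longleftrightarrow> (\<exists>us x vs. s = us @ x # vs \<and> c = rank (set (x # vs)) x)"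
proof (induction s)
  case (Cons y s)
  then show ?case
    unfolding rank_enc_Cons[OF Cons.prems] by (auto simp: Cons_eq_append_conv)
qed simp

lemma Omega_basis_rank_enc:
  assumes "b \<in> Omega_basis k"
  shows "Suc k \<in> set (rank_enc b)"
proof -
  obtain a where b: "b = (k + 1) # a"
    using assms by (auto simp: Omega_basis_def)
  have "distinct b" "set b = {1..k + 1}"
    using Omega_basis_perms[OF assms] by (auto simp: perms_def)
  then show ?thesis
    using rank_atLeastAtMost[of "k + 1" "k + 1"] rank_enc_Cons[of "k + 1" a] b by simp
qed

text \<open>An entry with code letter above \<open>k\<close> is followed by \<open>k\<close> smaller entries, and together they
  form an occurrence of a member of \<open>Omega_basis k\<close>. Conversely, a member of \<open>Omega_basis k\<close> has the
  code letter \<open>k + 1\<close>, and deletions never increase a letter.\<close>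

lemma Omega_iff:
  assumes "p \<in> perms"
  shows "p \<in> Omega k \<longleftrightarrow> set (rank_enc p) \<subseteq> {1..k}"
proof
  have d: "distinct p"
    using assms by (rule perms_distinct)
  assume p: "p \<in> Omega k"
  show "set (rank_enc p) \<subseteq> {1..k}"
  proof
    fix c assume "c \<in> set (rank_enc p)"
    then obtain us x vs where split: "p = us @ x # vs" and c: "c = rank (set (x # vs)) x"
      using set_rank_enc_conv[OF d] by blast
    let ?C = "{y \<in> set vs. y \<le> x}"
    have x: "x \<notin> set vs" and dvs: "distinct vs"
      using d split by auto
    then have cC: "c = Suc (card ?C)"
      using c rank_insert[of "set vs" x x] by (simp add: rank_def[of "set vs"])
    have "\<not> k \<le> card ?C"
    proof
      assume "k \<le> card ?C"
      then obtain D where D: "D \<subseteq> ?C" "card D = k"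
        by (meson obtain_subset_with_card_n)
      let ?t = "x # filter (\<lambda>y. y \<in> D) vs"
      have setD: "set (filter (\<lambda>y. y \<in> D) vs) = D"
        using D(1) by auto
      have dt: "distinct ?t"
        using x dvs by simp
      have lt: "length ?t = k + 1"
        using distinct_card[of "filter (\<lambda>y. y \<in> D) vs"] dvs setD D(2) by simp
      have sub: "subseq ?t p"
        unfolding split by (intro list_emb_append2 subseq_Cons2 subseq_filter_left)
      obtain b where b: "b \<in> perms" "order_iso b ?t"
        using standardize[OF dt] by blast
      have lb: "length b = k + 1"
        using b(2) lt by (simp add: order_iso_def)
      then obtain z a where za: "b = z # a"
        by (cases b) auto
      have dza: "distinct (z # a)" and sza: "set (z # a) = {1..k + 1}"
        using b(1) lb za by (auto simp: perms_def)
      have "a ! i < z" if i: "i < length a" for i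
      proof -
        have "?t ! Suc i \<in> D"
          using i lb lt za setD nth_mem[of i "filter (\<lambda>y. y \<in> D) vs"] by simp
        then have "?t ! Suc i < ?t ! 0"
          using D(1) x by (auto simp: less_le)
        then show ?thesis
          using b(2)[unfolded order_iso_def, THEN conjunct2, rule_format, of "Suc i" 0] i za by simp
      qed
      then have below: "\<forall>y\<in>set a. y < z"
        by (metis in_set_conv_nth)
      have "k + 1 \<in> set (z # a)" "z \<in> {1..k + 1}"
        using sza by auto
      then have z: "z = k + 1"
        using below by fastforce
      have "set a = {1..k + 1} - {k + 1}"
        using sza dza z by auto
      also have "\<dots> = {1..k}"
        by auto
      finally have "a \<in> perms" "length a = k"
        using dza lb za by (auto simp: perms_def)
      then have "b \<in> Omega_basis k"
        using za z by (auto simp: Omega_basis_def)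
      moreover have "b \<preceq> p"
        using sub b(2) by (auto simp: involved_def)
      ultimately show False
        using p by (auto simp: Omega_def)
    qed
    then show "c \<in> {1..k}"
      using cC by auto
  qed
next
  assume codes: "set (rank_enc p) \<subseteq> {1..k}"
  have "\<not> b \<preceq> p" if b: "b \<in> Omega_basis k" for b
  proof
    assume "b \<preceq> p"
    then obtain t where t: "subseq t p" "order_iso b t"
      by (auto simp: involved_def)
    obtain K where "rank_enc t = thin K (rank_enc p)"
      using subseq_imp_thin[OF perms_distinct[OF assms] t(1)] by blast
    then have "Suc k \<in> set (thin K (rank_enc p))"
      using Omega_basis_rank_enc[OF b] order_iso_imp_rank_enc_eq[OF t(2)] by simp
    then show False
      using thin_letter_le codes by fastforce
  qed
  then show "p \<in> Omega k"
    using assms by (simp add: Omega_def)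
qed

lemma Omega_perms: "Omega k \<subseteq> perms"
  by (auto simp: Omega_def)

fun valid_code :: "nat list \<Rightarrow> bool" where
  "valid_code [] \<longleftrightarrow> True"
| "valid_code (c # w) \<longleftrightarrow> 1 \<le> c \<and> c \<le> Suc (length w) \<and> valid_code w"

lemma valid_code_rank_enc: "distinct s \<Longrightarrow> valid_code (rank_enc s)"
proof (induction s)
  case (Cons x s)
  have "rank (set (x # s)) x = Suc (rank (set s) x)"
    using Cons.prems by (simp add: rank_insert)
  moreover have "rank (set s) x \<le> card (set s)"
    unfolding rank_def by (intro card_mono) auto
  ultimately show ?case
    using Cons card_length[of s] rank_enc_Cons[OF Cons.prems] by simp
qed simp

text \<open>The first letter of a code is the first entry of the permutation; the remaining entries are
  obtained by decoding the tail and making room for it.\<close>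

lemma valid_code_decode: "valid_code w \<Longrightarrow> \<exists>p\<in>perms. rank_enc p = w"
proof (induction w)
  case Nil
  show ?case
    by (rule bexI[of _ "[]"]) (simp_all add: perms_def)
next
  case (Cons c w)
  then obtain p where p: "p \<in> perms" "rank_enc p = w"
    by auto
  define up where "up v = (if v < c then v else Suc v)" for v :: nat
  let ?n = "length w"
  have len: "length p = ?n"
    using p(2) by auto
  have dp: "distinct p" and sp: "set p = {1..?n}"
    using p(1) len by (auto simp: perms_def)
  have c: "1 \<le> c" "c \<le> Suc ?n"
    using Cons.prems by auto
  have up_less: "up u < up v \<longleftrightarrow> u < v" for u v
    by (auto simp: up_def)
  then have inj: "inj up"
    by (metis injI linorder_neq_iff)
  have img: "insert c (up ` {1..?n}) = {1..Suc ?n}"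
  proof
    show "{1..Suc ?n} \<subseteq> insert c (up ` {1..?n})"
    proof
      fix v assume v: "v \<in> {1..Suc ?n}"
      consider "v < c" | "v = c" | "c < v" by linarith
      then show "v \<in> insert c (up ` {1..?n})"
      proof cases
        case 1
        then show ?thesis
          using v c by (intro insertI2 image_eqI[of _ _ v]) (auto simp: up_def)
      next
        case 3
        then show ?thesis
          using v c by (intro insertI2 image_eqI[of _ _ "v - 1"]) (auto simp: up_def)
      qed simp
    qed
  qed (use c in \<open>auto simp: up_def\<close>)
  have c_up: "c \<notin> up ` A" for A
    by (auto simp: up_def)
  let ?q = "c # map up p"
  have sq: "set ?q = {1..Suc ?n}"
    using img sp by simp
  have dq: "distinct ?q"
    using dp c_up inj by (auto simp: distinct_map inj_on_def)
  have "order_iso (map up p) p"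
    by (simp add: order_iso_def up_less)
  then have "rank_enc ?q = c # w"
    unfolding rank_enc_Cons[OF dq] sq
    using order_iso_imp_rank_enc_eq p(2) c rank_atLeastAtMost[of c "Suc ?n"] by simp
  moreover have "?q \<in> perms"
    using sq dq len by (simp add: perms_def)
  ultimately show ?case by blast
qed

lemma rank_enc_Omega: "rank_enc ` Omega k = {w \<in> lists {1..k}. valid_code w}"
proof
  show "rank_enc ` Omega k \<subseteq> {w \<in> lists {1..k}. valid_code w}"
  proof
    fix w assume "w \<in> rank_enc ` Omega k"
    then obtain p where "p \<in> Omega k" "w = rank_enc p"
      by blast
    then show "w \<in> {w \<in> lists {1..k}. valid_code w}"
      using Omega_iff Omega_perms perms_distinct valid_code_rank_enc by blast
  qed
  show "{w \<in> lists {1..k}. valid_code w} \<subseteq> rank_enc ` Omega k"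
  proof
    fix w assume w: "w \<in> {w \<in> lists {1..k}. valid_code w}"
    then obtain p where "p \<in> perms" "rank_enc p = w"
      using valid_code_decode by blast
    then show "w \<in> rank_enc ` Omega k"
      using w Omega_iff by blast
  qed
qed

text \<open>A letter \<open>c\<close> demands that at least \<open>c - 1\<close> letters follow it. While a code is read, only the
  strongest outstanding demand has to be remembered, and it stays at most \<open>k\<close>.\<close>

lemma recognizable_Omega: "recognizable (rank_enc ` Omega k)"
proof -
  define V where "V c = {w \<in> lists {1..k}. valid_code w \<and> c \<le> length w}" for c
  have "\<exists>\<G>\<subseteq>V ` {..k}. residual [a] L = \<Union>\<G>" if L: "L \<in> V ` {..k}" for L a
  proof -
    obtain c where c: "c \<le> k" "L = V c"
      using L by blast
    show ?thesis
    proof (cases "a \<in> {1..k}")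
      case True
      then have "residual [a] L = \<Union>{V (max c a - 1)}"
        by (auto simp: c(2) V_def residual_def)
      moreover have "max c a - 1 \<le> k"
        using c(1) True by auto
      ultimately show ?thesis by blast
    next
      case False
      then have "residual [a] L = \<Union>{}"
        by (auto simp: c(2) V_def residual_def)
      then show ?thesis by blast
    qed
  qed
  then have "recognizable (\<Union>{V 0})"
    by (rule recognizable_Union_family[rotated]) auto
  then show ?thesis
    by (simp add: V_def rank_enc_Omega)
qed

section \<open>Regularity of the strict upward closure\<close>

definition strictly_above :: "nat \<Rightarrow> nat list set \<Rightarrow> nat list set" where
  "strictly_above m S = {p \<in> Omega m. \<exists>s\<in>S. s \<preceq> p \<and> s \<noteq> p}"

text \<open>The strictness of the length condition makes this language describe proper involvement.\<close>

definition thinnable :: "nat \<Rightarrow> nat list set \<Rightarrow> nat list set" where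
  "thinnable m L = {w \<in> lists {1..m}. \<exists>K. thin K w \<in> L \<and> length (thin K w) < length w}"

lemma rank_enc_strictly_above:
  assumes "S \<subseteq> perms"
  shows "rank_enc ` strictly_above m S = rank_enc ` Omega m \<inter> thinnable m (rank_enc ` S)"
proof (intro set_eqI iffI)
  fix w assume "w \<in> rank_enc ` strictly_above m S"
  then obtain p s where p: "p \<in> Omega m" "w = rank_enc p" and s: "s \<in> S" "s \<preceq> p" "s \<noteq> p"
    by (auto simp: strictly_above_def)
  obtain t where t: "subseq t p" "order_iso s t"
    using s(2) by (auto simp: involved_def)
  have pp: "p \<in> perms"
    using p(1) Omega_perms by blast
  obtain K where K: "rank_enc t = thin K w"
    using subseq_imp_thin[OF perms_distinct[OF pp] t(1)] p(2) by blast
  have st: "thin K w = rank_enc s"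
    using order_iso_imp_rank_enc_eq[OF t(2)] K by simp
  have "length s < length p"
    using s assms involved_length[OF s(2)] involved_same_length[OF _ pp s(2)] by fastforce
  then have "thin K w \<in> rank_enc ` S" "length (thin K w) < length w"
    using s(1) p(2) unfolding st by auto
  moreover have "w \<in> lists {1..m}"
    using p Omega_iff[OF pp] by auto
  ultimately show "w \<in> rank_enc ` Omega m \<inter> thinnable m (rank_enc ` S)"
    using p by (auto simp: thinnable_def)
next
  fix w assume w: "w \<in> rank_enc ` Omega m \<inter> thinnable m (rank_enc ` S)"
  then obtain p where p: "p \<in> Omega m" "w = rank_enc p"
    by blast
  from w obtain K s where s: "s \<in> S" "thin K w = rank_enc s" "length (thin K w) < length w"
    unfolding thinnable_def by blast
  have d: "distinct p" "distinct s"
    using p(1) s(1) Omega_perms assms perms_distinct by blast+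
  let ?t = "filter (\<lambda>x. rank (set p) x \<in> K) p"
  have "rank_enc s = rank_enc ?t"
    using thin_rank_enc[OF d(1)] s(2) p(2) by simp
  then have "order_iso s ?t"
    using d by (intro rank_enc_eq_imp_order_iso) auto
  then have "s \<preceq> p"
    unfolding involved_def using subseq_filter_left by blast
  moreover have "s \<noteq> p"
    using s(2,3) p(2) by auto
  ultimately show "w \<in> rank_enc ` strictly_above m S"
    using p s(1) by (auto simp: strictly_above_def)
qed

text \<open>A letter of size at most \<open>m\<close> only looks at the window \<open>K \<inter> {1..m}\<close> of the set \<open>K\<close> that governs
  the deletion. So an automaton can simulate \<open>thin K\<close>, guessing one new bit of \<open>K\<close> whenever the
  window moves; this bit is unconstrained because \<open>K\<close> is. Its states \<open>(H, R, b)\<close> hold the window, the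
  residual of \<open>L\<close> that the rest of the output has to meet, and whether a letter has been deleted.\<close>

lemma recognizable_thinnable:
  assumes "recognizable L"
  shows "recognizable (thinnable m L)"
proof -
  define T where "T H R b = {w \<in> lists {1..m}. \<exists>K. K \<inter> {1..m} = H \<and> thin K w \<in> R \<and>
      (b \<or> length (thin K w) < length w)}" for H R b
  let ?Res = "range (\<lambda>u. residual u L)"
  let ?\<F> = "(\<lambda>(H, R, b). T H R b) ` (Pow {1..m} \<times> ?Res \<times> UNIV)"
  have fin: "finite ?\<F>"
    using assms by (auto simp: recognizable_def)
  have T_mem: "T H R b \<in> ?\<F>" if "H \<subseteq> {1..m}" "R \<in> ?Res" for H R b
    using that by (intro image_eqI[of _ _ "(H, R, b)"]) auto
  have step: "\<exists>\<G>\<subseteq>?\<F>. residual [a] M = \<Union>\<G>" if M: "M \<in> ?\<F>" for M a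
  proof -
    obtain H u b where H: "H \<subseteq> {1..m}" and M: "M = T H (residual u L) b"
      using M by auto
    let ?R = "residual u L"
    show ?thesis
    proof (cases "a \<in> {1..m}")
      case False
      then have "residual [a] M = \<Union>{}"
        by (auto simp: M T_def residual_def)
      then show ?thesis by blast
    next
      case a: True
      define R' where "R' = (if a \<in> H then residual [card (H \<inter> {1..a})] ?R else ?R)"
      define b' where "b' \<longleftrightarrow> b \<or> a \<notin> H"
      define \<H> where "\<H> = {H' \<in> Pow {1..m}. H' \<inter> {1..<m} = close_gap a H \<inter> {1..<m}}"
      have R': "R' \<in> ?Res"
        by (auto simp: R'_def simp flip: residual_append)
      have one: "(thin K (a # w) \<in> ?R \<and> (b \<or> length (thin K (a # w)) < length (a # w))) \<longleftrightarrow>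
          thin (close_gap a K) w \<in> R' \<and> (b' \<or> length (thin (close_gap a K) w) < length w)"
        if K: "K \<inter> {1..m} = H" for K w
      proof -
        have "a \<in> K \<longleftrightarrow> a \<in> H" "K \<inter> {1..a} = H \<inter> {1..a}"
          using K a by auto
        then show ?thesis
          using length_thin_le[of "close_gap a K" w]
          by (auto simp: R'_def b'_def mem_residual less_Suc_eq_le)
      qed
      have "residual [a] M = \<Union>((\<lambda>H'. T H' R' b') ` \<H>)"
      proof (intro set_eqI iffI)
        fix w assume "w \<in> residual [a] M"
        then obtain K where w: "w \<in> lists {1..m}" and K: "K \<inter> {1..m} = H"
          and acc: "thin K (a # w) \<in> ?R" "b \<or> length (thin K (a # w)) < length (a # w)"
          by (auto simp: M T_def residual_def)
        let ?K = "close_gap a K"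
        have "?K \<inter> {1..m} \<in> \<H>"
          using K a by (auto simp: \<H>_def close_gap_def split: if_splits)
        moreover have "w \<in> T (?K \<inter> {1..m}) R' b'"
          unfolding T_def using w acc one[OF K] by blast
        ultimately show "w \<in> \<Union>((\<lambda>H'. T H' R' b') ` \<H>)"
          by blast
      next
        fix w assume "w \<in> \<Union>((\<lambda>H'. T H' R' b') ` \<H>)"
        then obtain H' K' where H': "H' \<in> \<H>" and K': "K' \<inter> {1..m} = H'" and w: "w \<in> lists {1..m}"
          and acc: "thin K' w \<in> R'" "b' \<or> length (thin K' w) < length w"
          by (auto simp: T_def)
        \<comment> \<open>reopen the gap at \<open>a\<close>, with the bit at \<open>a\<close> prescribed by \<open>H\<close>\<close>
        define K where "K = {v. if v < a then v \<in> K' else if v = a then a \<in> H else v - 1 \<in> K'}"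
        have gap: "close_gap a K = K'"
          by (auto simp: K_def close_gap_def)
        have agree: "v \<in> K' \<longleftrightarrow> v \<in> close_gap a H" if "v \<in> {1..<m}" for v
          using H' K' that unfolding \<H>_def by fastforce
        have "v \<in> K \<longleftrightarrow> v \<in> H" if v: "v \<in> {1..m}" for v
        proof -
          consider "v < a" | "v = a" | "a < v" by linarith
          then show ?thesis
          proof cases
            case 1
            then show ?thesis
              using agree[of v] v a by (auto simp: K_def close_gap_def)
          next
            case 2
            then show ?thesis by (simp add: K_def)
          next
            case 3
            then show ?thesis
              using agree[of "v - 1"] v a by (cases v) (auto simp: K_def close_gap_def)
          qed
        qed
        then have K: "K \<inter> {1..m} = H"
          using H by blast
        have "thin K (a # w) \<in> ?R \<and> (b \<or> length (thin K (a # w)) < length (a # w))"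
          unfolding one[OF K] gap using acc by (rule conjI)
        moreover have "a # w \<in> lists {1..m}"
          using w a by simp
        ultimately have "a # w \<in> M"
          unfolding M T_def using K by blast
        then show "w \<in> residual [a] M"
          by (simp add: residual_def)
      qed
      moreover have "(\<lambda>H'. T H' R' b') ` \<H> \<subseteq> ?\<F>"
        using T_mem R' by (auto simp: \<H>_def)
      ultimately show ?thesis by blast
    qed
  qed
  have "residual [] L \<in> ?Res"
    by blast
  then have "(\<lambda>H. T H L False) ` Pow {1..m} \<subseteq> ?\<F>"
    using T_mem by auto
  then have "recognizable (\<Union>((\<lambda>H. T H L False) ` Pow {1..m}))"
    using recognizable_Union_family[OF fin step] by blast
  also have "\<Union>((\<lambda>H. T H L False) ` Pow {1..m}) = thinnable m L"
    by (auto simp: T_def thinnable_def)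
  finally show ?thesis .
qed

lemma recognizable_strictly_above:
  assumes "S \<subseteq> perms" "recognizable (rank_enc ` S)"
  shows "recognizable (rank_enc ` strictly_above m S)"
  using assms
  by (simp add: rank_enc_strictly_above recognizable_Int recognizable_Omega recognizable_thinnable)

section \<open>Closed sets and their bases\<close>

lemma regular_perms_iff:
  "regular_perms S \<longleftrightarrow> (\<exists>m\<ge>1. S \<subseteq> Omega m) \<and> recognizable (rank_enc ` S)"
proof -
  have "regular_lang {1..m} (rank_enc ` S) \<longleftrightarrow> recognizable (rank_enc ` S)" if "S \<subseteq> Omega m" for m
  proof
    assume "recognizable (rank_enc ` S)"
    moreover have "rank_enc ` S \<subseteq> lists {1..m}"
      using image_mono[OF that, of rank_enc] unfolding rank_enc_Omega by auto
    ultimately show "regular_lang {1..m} (rank_enc ` S)"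
      by (rule recognizable_imp_regular_lang)
  qed (rule regular_lang_imp_recognizable)
  then show ?thesis
    unfolding regular_perms_def by metis
qed

lemma rank_enc_image_Diff:
  "S \<subseteq> perms \<Longrightarrow> T \<subseteq> perms \<Longrightarrow> rank_enc ` (S - T) = rank_enc ` S - rank_enc ` T"
  using inj_on_rank_enc by (rule inj_on_image_set_diff) auto

text \<open>A permutation outside \<open>Omega (k + 1)\<close> involves some \<open>(k + 2) a\<close>. Deleting an entry of \<open>a\<close>
  leaves a permutation that is still outside \<open>Omega k\<close>, so the original one was not minimal.\<close>

lemma basis_subset_Omega:
  assumes "X \<subseteq> Omega k"
  shows "basis X \<subseteq> Omega (k + 1)"
proof
  fix p assume p: "p \<in> basis X"
  show "p \<in> Omega (k + 1)"
  proof (rule ccontr)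
    assume "p \<notin> Omega (k + 1)"
    then obtain b where b: "b \<in> Omega_basis (k + 1)" "b \<preceq> p"
      using p by (auto simp: Omega_def basis_def)
    then obtain a where a: "b = (k + 2) # a" "a \<in> perms" "length a = k + 1"
      by (auto simp: Omega_basis_def)
    then obtain y c where c: "a = y # c"
      by (cases a) auto
    let ?t = "(k + 2) # c"
    have sa: "set a = {1..k + 1}" and da: "distinct a"
      using a by (auto simp: perms_def)
    have dt: "distinct ?t"
      using sa da c by auto
    have "v \<le> k + 2" if "v \<in> set ?t" for v
      using that sa c by (metis Suc_eq_plus1 add_2_eq_Suc' atLeastAtMost_iff le_SucI le_refl
          list.set_intros(2) set_ConsD)
    then have "{v \<in> set ?t. v \<le> k + 2} = set ?t"
      by blast
    then have "rank (set ?t) (k + 2) = length ?t"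
      unfolding rank_def using distinct_card[OF dt] by simp
    also have "\<dots> = k + 1"
      using a(3) c by simp
    finally have big: "k + 1 \<in> set (rank_enc ?t)"
      using rank_enc_Cons[OF dt] by simp
    obtain q where q: "q \<in> perms" "order_iso q ?t"
      using standardize[OF dt] by blast
    have "k + 1 \<in> set (rank_enc q)"
      using big order_iso_imp_rank_enc_eq[OF q(2)] by simp
    then have "q \<notin> Omega k"
      using Omega_iff[OF q(1)] by auto
    then have "q \<notin> X"
      using assms by blast
    have "subseq ?t b"
      unfolding a(1) c by (intro subseq_Cons2) auto
    then have "q \<preceq> b"
      using q(2) by (auto simp: involved_def)
    then have "q \<preceq> p"
      using b(2) by (rule involved_trans)
    then have "q = p"
      using p q(1) \<open>q \<notin> X\<close> by (auto simp: basis_def)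
    moreover have "length q < length b"
      using q(2) a(1) c by (simp add: order_iso_def)
    ultimately show False
      using involved_length[OF b(2)] by simp
  qed
qed

lemma closed_eq_Omega_Diff:
  assumes "perm_closed X" "X \<subseteq> Omega k"
  shows "X = Omega k - (basis X \<union> strictly_above k (basis X))"
proof -
  have eq: "X = {p \<in> perms. \<forall>b\<in>basis X. \<not> b \<preceq> p}"
    using assms(1) by (rule closed_eq_avoid)
  have "p \<in> basis X \<union> strictly_above k (basis X) \<longleftrightarrow> p \<notin> X" if p: "p \<in> Omega k" for p
  proof -
    have "p \<in> perms"
      using p Omega_perms by blast
    then have "p \<notin> X \<longleftrightarrow> (\<exists>b\<in>basis X. b \<preceq> p)"
      using eq by blast
    then show ?thesis
      using p involved_refl unfolding strictly_above_def by blast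
  qed
  then show ?thesis
    using assms(2) by blast
qed

lemma basis_eq_minimal:
  assumes "basis X \<subseteq> Omega m"
  shows "basis X = (Omega m - X) - strictly_above m (Omega m - X)"
proof (intro set_eqI iffI)
  fix p assume p: "p \<in> basis X"
  then show "p \<in> (Omega m - X) - strictly_above m (Omega m - X)"
    using assms Omega_perms unfolding basis_def strictly_above_def by blast
next
  fix p assume p: "p \<in> (Omega m - X) - strictly_above m (Omega m - X)"
  have "q = p" if q: "q \<in> perms" "q \<notin> X" "q \<preceq> p" for q
  proof -
    have "q \<in> Omega m"
      using Omega_closed p q unfolding perm_closed_def by blast
    then show ?thesis
      using p q unfolding strictly_above_def by blast
  qed
  then show "p \<in> basis X"
    using p Omega_perms unfolding basis_def by blast
qed

theorem theorem2:
  fixes k :: nat and X :: "nat list set"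
  assumes "k \<ge> 1" and "X \<subseteq> Omega k" and "perm_closed X"
  shows "regular_perms X \<longleftrightarrow> regular_perms (basis X)"
proof
  let ?B = "basis X"
  have perms: "X \<subseteq> perms" "?B \<subseteq> perms" "\<And>m S. strictly_above m S \<subseteq> perms"
    using assms(3) Omega_perms by (auto simp: perm_closed_def basis_def strictly_above_def)
  have B: "?B \<subseteq> Omega (k + 1)"
    using assms(2) by (rule basis_subset_Omega)
  {
    assume "regular_perms X"
    let ?Y = "Omega (k + 1) - X"
    have Y: "?Y \<subseteq> perms"
      using Omega_perms by blast
    have "recognizable (rank_enc ` ?Y)"
      using \<open>regular_perms X\<close> perms(1) Omega_perms
      by (simp add: regular_perms_iff rank_enc_image_Diff recognizable_Diff recognizable_Omega)
    then have "recognizable (rank_enc ` (?Y - strictly_above (k + 1) ?Y))"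
      unfolding rank_enc_image_Diff[OF Y perms(3)]
      using Y by (intro recognizable_Diff recognizable_strictly_above)
    then have "recognizable (rank_enc ` ?B)"
      by (simp only: basis_eq_minimal[OF B, symmetric])
    then show "regular_perms ?B"
      unfolding regular_perms_iff using B le_add2 by blast
  next
    assume "regular_perms ?B"
    then have "recognizable (rank_enc ` ?B)"
      by (simp add: regular_perms_iff)
    then have "recognizable (rank_enc ` (?B \<union> strictly_above k ?B))"
      using perms(2) by (simp add: image_Un recognizable_Un recognizable_strictly_above)
    then have "recognizable (rank_enc ` (Omega k - (?B \<union> strictly_above k ?B)))"
      using perms Omega_perms
      by (simp add: rank_enc_image_Diff recognizable_Diff recognizable_Omega)
    then have "recognizable (rank_enc ` X)"
      by (simp only: closed_eq_Omega_Diff[OF assms(3,2), symmetric])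
    then show "regular_perms X"
      unfolding regular_perms_iff using assms(1,2) by blast
  }
qed

end
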